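(* Let the original layer $A\in\mathbb R^{n\times m}$ decompose as $$A=S+Q+P,\qquad S\odot Q=S\odot P=Q\odot P=0,$$ where $P$ is interpreted as the entries finally removed and $Q$ as entries restored (kept) from an over-pruned reservoir. Define $A_\theta:=S+Q+\theta P$ for $0\le\theta\le1$. For constants $\lambda_2,\lambda_1\ge0$ and the elastic-net objective $$\mathcal J(A):=\mathcal L_{\mathrm{CE}}(A)+\lambda_2\|A\|_F^2+\lambda_1\|A\|_1+\mathcal C$$ ($\mathcal C$ independent of $A$), one has for every $\theta\in[0,1]$ $$\mathcal J(A_\theta)-\mathcal J(A)\le(1-\theta)B_T(P)-\lambda_2(1-\theta^2)\|P\|_F^2-\lambda_1(1-\theta)\|P\|_1.$$ For the final prune--restore layer $S+Q$, $$\mathcal J(S+Q)\le\mathcal J(A)-\lambda_2\|P\|_F^2-\lambda_1\|P\|_1+B_T(P).$$ Consequently, the final mask is certified to decrease the elastic-net objective (i.e. $\mathcal J(S+Q)<\mathcal J(A)$) whenever $$B_T(P)<\lambda_2\|P\|_F^2+\lambda_1\|P\|_1.$$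
   Context: $T$ is a finite nonempty training set with correct classes $C(s)\in\{1,\dots,K\}$. A target layer $A\in\mathbb R^{n\times m}$ sits inside a network whose logits are $z_A(s):=\psi_2(A\psi_1(s))\in\mathbb R^K$, where $\psi_1$ (values in $\mathbb R^m$) and $\psi_2:\mathbb R^n\to\mathbb R^K$ are the pre- and post-layer maps with all other parameters frozen. The cross-entropy is $$\mathcal L_{\mathrm{CE}}(A):=\frac1{|T|}\sum_{s\in T}\Big[-z_A(s)_{C(s)}+\log\Big(\sum_{j=1}^K e^{z_A(s)_j}\Big)\Big].$$ $L_s\ge0$ is any finite upper bound on the local $\ell_\infty$-Lipschitz constant of $\psi_2$ on $\{A_\theta\psi_1(s):0\le\theta\le1\}$, i.e. $\|\psi_2(v)-\psi_2(w)\|_\infty\le L_s\|v-w\|_\infty$ for all $v,w$ in this set, and $B_T(P):=\frac2{|T|}\sum_{s\in T}L_s\|P\psi_1(s)\|_\infty$. Here $\odot$ is the entrywise product, $\|\cdot\|_F$ the Frobenius norm, $\|\cdot\|_1$ the entrywise $\ell_1$ norm, and $\|\cdot\|_\infty$ the vector maximum norm. *)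

theory Defs
  imports "HOL-Analysis.Analysis"
begin

text \<open>
  An \<open>n \<times> m\<close> matrix is an element of \<^typ>\<open>real^'m^'n\<close>, and the classes \<open>1, \<dots>, K\<close> are the elements
  of a finite type \<open>'k\<close>. The vector maximum norm is \<^const>\<open>infnorm\<close>, and multiplication of nested
  vectors (as opposed to \<open>**\<close>) is entrywise. The norm of \<^typ>\<open>real^'m^'n\<close> is the Frobenius norm:
\<close>

lemma norm_matrix_frobenius:
  fixes A :: "real^'m^'n"
  shows "norm A = sqrt (\<Sum>i\<in>UNIV. \<Sum>j\<in>UNIV. (A $ i $ j)\<^sup>2)"
  by (simp add: norm_vec_def L2_set_def sum_nonneg)

abbreviation hadamard :: "real^'m^'n \<Rightarrow> real^'m^'n \<Rightarrow> real^'m^'n" (infixl "\<odot>" 70)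
  where "A \<odot> B \<equiv> A * B"

lemma hadamard_nth: "(A \<odot> B) $ i $ j = A $ i $ j * B $ i $ j"
  by simp

definition entry_l1_norm :: "real^'m^'n \<Rightarrow> real"
  where "entry_l1_norm A = (\<Sum>i\<in>UNIV. \<Sum>j\<in>UNIV. \<bar>A $ i $ j\<bar>)"

definition logits :: "('s \<Rightarrow> real^'m) \<Rightarrow> (real^'n \<Rightarrow> real^'k) \<Rightarrow> real^'m^'n \<Rightarrow> 's \<Rightarrow> real^'k"
  where "logits \<psi>1 \<psi>2 A s = \<psi>2 (A *v \<psi>1 s)"

definition cross_entropy ::
  "'s set \<Rightarrow> ('s \<Rightarrow> 'k) \<Rightarrow> ('s \<Rightarrow> real^'m) \<Rightarrow> (real^'n \<Rightarrow> real^'k) \<Rightarrow> real^'m^'n \<Rightarrow> real"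
  where "cross_entropy T C \<psi>1 \<psi>2 A =
    1 / real (card T) *
      (\<Sum>s\<in>T. - (logits \<psi>1 \<psi>2 A s $ C s) + ln (\<Sum>j\<in>UNIV. exp (logits \<psi>1 \<psi>2 A s $ j)))"

text \<open>The real number \<open>c\<close> is the part of the objective that does not depend on the layer.\<close>

definition elastic_net ::
  "'s set \<Rightarrow> ('s \<Rightarrow> 'k) \<Rightarrow> ('s \<Rightarrow> real^'m) \<Rightarrow> (real^'n \<Rightarrow> real^'k) \<Rightarrow>
    real \<Rightarrow> real \<Rightarrow> real \<Rightarrow> real^'m^'n \<Rightarrow> real"
  where "elastic_net T C \<psi>1 \<psi>2 lam2 lam1 c A =
    cross_entropy T C \<psi>1 \<psi>2 A + lam2 * (norm A)\<^sup>2 + lam1 * entry_l1_norm A + c"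

definition layer_path :: "real^'m^'n \<Rightarrow> real^'m^'n \<Rightarrow> real^'m^'n \<Rightarrow> real \<Rightarrow> real^'m^'n"
  where "layer_path S Q P \<theta> = S + Q + \<theta> *\<^sub>R P"

text \<open>Unlike \<^const>\<open>lipschitz_on\<close>, this measures distances in the maximum norm.\<close>

definition linf_lipschitz_bound :: "real \<Rightarrow> (real^'n) set \<Rightarrow> (real^'n \<Rightarrow> real^'k) \<Rightarrow> bool"
  where "linf_lipschitz_bound L V f \<longleftrightarrow>
    0 \<le> L \<and> (\<forall>v\<in>V. \<forall>w\<in>V. infnorm (f v - f w) \<le> L * infnorm (v - w))"

definition perturbation_budget ::
  "'s set \<Rightarrow> ('s \<Rightarrow> real^'m) \<Rightarrow> ('s \<Rightarrow> real) \<Rightarrow> real^'m^'n \<Rightarrow> real"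
  where "perturbation_budget T \<psi>1 L P =
    2 / real (card T) * (\<Sum>s\<in>T. L s * infnorm (P *v \<psi>1 s))"

end

theory Submission
  imports Defs
begin

text \<open>
  The map \<open>z \<mapsto> - z $ k + ln (\<Sum>j. exp (z $ j))\<close> is 2-Lipschitz for the maximum norm, once through the
  linear term and once through log-sum-exp, so moving from \<open>A\<close> to \<open>A\<^sub>\<theta>\<close> costs at most
  \<open>(1 - \<theta>) B\<^sub>T(P)\<close> in cross-entropy. The disjoint supports make both penalties split exactly
  along the path, with \<open>P\<close> contributing \<open>\<theta>\<^sup>2 \<parallel>P\<parallel>\<^sub>F\<^sup>2\<close> and \<open>\<theta> \<parallel>P\<parallel>\<^sub>1\<close>. The remaining
  claims are the case \<open>\<theta> = 0\<close>.
\<close>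

text \<open>Each coordinate of \<open>x\<close> exceeds that of \<open>y\<close> by at most
  \<open>?r\<close>, so the sum of exponentials grows at most by the factor \<open>exp ?r\<close>,
  which the logarithm turns into the summand \<open>?r\<close>.\<close>

lemma log_sum_exp_diff_le_infnorm:
  fixes x y :: "real^'k::finite"
  shows "ln (\<Sum>j\<in>UNIV. exp (x $ j)) - ln (\<Sum>j\<in>UNIV. exp (y $ j)) \<le> infnorm (x - y)"
proof -
  let ?r = "infnorm (x - y)"
  have pos: "0 < (\<Sum>j\<in>UNIV. exp (z $ j))" for z :: "real^'k"
    by (intro sum_pos) auto
  have "x $ j \<le> ?r + y $ j" for j
    using component_le_infnorm_cart[of "x - y" j] by simp
  then have "(\<Sum>j\<in>UNIV. exp (x $ j)) \<le> (\<Sum>j\<in>UNIV. exp ?r * exp (y $ j))"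
    by (intro sum_mono) (simp flip: exp_add)
  then have "ln (\<Sum>j\<in>UNIV. exp (x $ j)) \<le> ln (exp ?r * (\<Sum>j\<in>UNIV. exp (y $ j)))"
    using pos[of x] unfolding sum_distrib_left by (rule ln_mono)
  also have "\<dots> = ?r + ln (\<Sum>j\<in>UNIV. exp (y $ j))"
    using pos[of y] by (subst ln_mult) auto
  finally show ?thesis by simp
qed

lemma cross_entropy_diff_le:
  fixes C :: "'s \<Rightarrow> 'k::finite"
  assumes "\<And>s. s \<in> T \<Longrightarrow> infnorm (logits \<psi>1 \<psi>2 A s - logits \<psi>1 \<psi>2 B s) \<le> d s"
  shows "cross_entropy T C \<psi>1 \<psi>2 A - cross_entropy T C \<psi>1 \<psi>2 B \<le> 2 / real (card T) * (\<Sum>s\<in>T. d s)"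
proof -
  let ?l = "\<lambda>A s. - (logits \<psi>1 \<psi>2 A s $ C s) + ln (\<Sum>j\<in>UNIV. exp (logits \<psi>1 \<psi>2 A s $ j))"
  have "?l A s - ?l B s \<le> 2 * d s" if "s \<in> T" for s
    using log_sum_exp_diff_le_infnorm[of "logits \<psi>1 \<psi>2 A s" "logits \<psi>1 \<psi>2 B s"]
      component_le_infnorm_cart[of "logits \<psi>1 \<psi>2 A s - logits \<psi>1 \<psi>2 B s" "C s"] assms[OF that]
    by simp
  then have "(\<Sum>s\<in>T. ?l A s - ?l B s) \<le> (\<Sum>s\<in>T. 2 * d s)"
    by (rule sum_mono)
  then have "1 / real (card T) * (\<Sum>s\<in>T. ?l A s - ?l B s) \<le> 1 / real (card T) * (\<Sum>s\<in>T. 2 * d s)"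
    by (rule mult_left_mono) simp
  then show ?thesis
    unfolding cross_entropy_def sum_subtractf
    by (simp only: right_diff_distrib flip: sum_distrib_left)
qed

text \<open>Pythagoras: matrices with disjoint supports are orthogonal for the entrywise inner
  product, which induces the Frobenius norm, so the cross terms vanish.\<close>

lemma norm_add_scaleR_hadamard:
  fixes R P :: "real^'m^'n"
  assumes "R \<odot> P = 0"
  shows "(norm (R + t *\<^sub>R P))\<^sup>2 = (norm R)\<^sup>2 + t\<^sup>2 * (norm P)\<^sup>2"
proof -
  have "R $ i $ j * P $ i $ j = 0" for i j
    using assms by (metis hadamard_nth zero_index)
  then have "inner R P = 0"
    unfolding inner_vec_def inner_real_def by (intro sum.neutral ballI)
  then show ?thesis
    by (simp add: power2_norm_eq_inner inner_add_left inner_add_right inner_commute[of P R]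
        power2_eq_square[of t])
qed

text \<open>At every entry one of \<open>R\<close> and \<open>P\<close> vanishes, so the triangle
  inequality is an equality there; \<open>0 \<le> t\<close> lets \<open>t\<close> leave the absolute
  value unchanged.\<close>

lemma entry_l1_norm_add_scaleR_hadamard:
  fixes R P :: "real^'m^'n"
  assumes "R \<odot> P = 0" and "0 \<le> t"
  shows "entry_l1_norm (R + t *\<^sub>R P) = entry_l1_norm R + t * entry_l1_norm P"
proof -
  have "\<bar>R $ i $ j + t * P $ i $ j\<bar> = \<bar>R $ i $ j\<bar> + t * \<bar>P $ i $ j\<bar>" for i j
  proof -
    have "R $ i $ j * P $ i $ j = 0"
      using assms(1) by (metis hadamard_nth zero_index)
    with \<open>0 \<le> t\<close> show ?thesis
      by (auto simp: abs_mult)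
  qed
  then show ?thesis
    by (simp add: entry_l1_norm_def sum.distrib sum_distrib_left)
qed

lemma cross_entropy_layer_path_diff_le:
  fixes C :: "'s \<Rightarrow> 'k::finite" and P :: "real^'m^'n"
  assumes lip: "\<And>s. s \<in> T \<Longrightarrow>
      linf_lipschitz_bound (L s) {layer_path S Q P \<theta> *v \<psi>1 s | \<theta>. 0 \<le> \<theta> \<and> \<theta> \<le> 1} \<psi>2"
    and \<theta>: "0 \<le> \<theta>" "\<theta> \<le> 1"
  shows "cross_entropy T C \<psi>1 \<psi>2 (layer_path S Q P \<theta>) - cross_entropy T C \<psi>1 \<psi>2 (layer_path S Q P 1)
    \<le> (1 - \<theta>) * perturbation_budget T \<psi>1 L P"
proof -
  have "infnorm (logits \<psi>1 \<psi>2 (layer_path S Q P \<theta>) s - logits \<psi>1 \<psi>2 (layer_path S Q P 1) s)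
      \<le> (1 - \<theta>) * (L s * infnorm (P *v \<psi>1 s))" if "s \<in> T" for s
  proof -
    \<comment> \<open>The layer output is affine in the path parameter with slope
      \<open>P *v \<psi>1 s\<close>. Since \<open>\<theta> \<le> 1\<close>, the absolute value of
      the scalar is \<open>1 - \<theta>\<close>.\<close>
    have "layer_path S Q P \<theta> *v \<psi>1 s - layer_path S Q P 1 *v \<psi>1 s = (\<theta> - 1) *\<^sub>R (P *v \<psi>1 s)"
      by (simp add: layer_path_def matrix_vector_mult_add_rdistrib scaleR_left_diff_distrib
          flip: scaleR_matrix_vector_assoc)
    then have eq: "infnorm (layer_path S Q P \<theta> *v \<psi>1 s - layer_path S Q P 1 *v \<psi>1 s)
        = (1 - \<theta>) * infnorm (P *v \<psi>1 s)"
      using \<theta> by (simp add: infnorm_mul)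
    \<comment> \<open>Both arguments of \<open>\<psi>2\<close> lie on the segment where the local
      Lipschitz bound holds, with parameters \<open>\<theta>\<close> and \<open>1\<close>.\<close>
    have "infnorm (\<psi>2 (layer_path S Q P \<theta> *v \<psi>1 s) - \<psi>2 (layer_path S Q P 1 *v \<psi>1 s))
        \<le> L s * infnorm (layer_path S Q P \<theta> *v \<psi>1 s - layer_path S Q P 1 *v \<psi>1 s)"
      using lip[OF that] \<theta> unfolding linf_lipschitz_bound_def by fastforce
    then show ?thesis
      by (simp add: logits_def eq algebra_simps)
  qed
  then have "cross_entropy T C \<psi>1 \<psi>2 (layer_path S Q P \<theta>) - cross_entropy T C \<psi>1 \<psi>2 (layer_path S Q P 1)
      \<le> 2 / real (card T) * (\<Sum>s\<in>T. (1 - \<theta>) * (L s * infnorm (P *v \<psi>1 s)))"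
    by (rule cross_entropy_diff_le)
  then show ?thesis
    unfolding perturbation_budget_def sum_distrib_left[symmetric] by (simp only: mult.left_commute)
qed

theorem theorem5p5:
  fixes T :: "'s set"
    and C :: "'s \<Rightarrow> 'k::finite"
    and \<psi>1 :: "'s \<Rightarrow> real^'m"
    and \<psi>2 :: "real^'n \<Rightarrow> real^'k"
    and A S Q P :: "real^'m^'n"
    and L :: "'s \<Rightarrow> real"
    and lam2 lam1 c :: real
  assumes "finite T" and "T \<noteq> {}"
    and "A = S + Q + P"
    and "S \<odot> Q = 0" and "S \<odot> P = 0" and "Q \<odot> P = 0"
    and "\<And>s. s \<in> T \<Longrightarrow>
      linf_lipschitz_bound (L s) {layer_path S Q P \<theta> *v \<psi>1 s | \<theta>. 0 \<le> \<theta> \<and> \<theta> \<le> 1} \<psi>2"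
    and "0 \<le> lam2" and "0 \<le> lam1"
  defines "J \<equiv> elastic_net T C \<psi>1 \<psi>2 lam2 lam1 c"
    and "B \<equiv> perturbation_budget T \<psi>1 L"
  shows "(\<forall>\<theta>\<in>{0..1}. J (layer_path S Q P \<theta>) - J A
            \<le> (1 - \<theta>) * B P - lam2 * (1 - \<theta>\<^sup>2) * (norm P)\<^sup>2 - lam1 * (1 - \<theta>) * entry_l1_norm P)
    \<and> J (S + Q) \<le> J A - lam2 * (norm P)\<^sup>2 - lam1 * entry_l1_norm P + B P
    \<and> (B P < lam2 * (norm P)\<^sup>2 + lam1 * entry_l1_norm P \<longrightarrow> J (S + Q) < J A)"
proof -
  have "(S + Q) \<odot> P = 0"
    using assms(5,6) by (simp add: distrib_right)
  note penalties = norm_add_scaleR_hadamard[OF this] entry_l1_norm_add_scaleR_hadamard[OF this]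
  \<comment> \<open>With \<open>A\<close> as the endpoint of the path, the penalty identities apply
    to it and to \<open>layer_path S Q P \<theta>\<close> with the same \<open>S + Q\<close>, whose
    own penalty cancels in the difference.\<close>
  have A: "A = layer_path S Q P 1"
    using assms(3) by (simp add: layer_path_def)
  have path: "J (layer_path S Q P \<theta>) - J A
      \<le> (1 - \<theta>) * B P - lam2 * (1 - \<theta>\<^sup>2) * (norm P)\<^sup>2 - lam1 * (1 - \<theta>) * entry_l1_norm P"
    if "0 \<le> \<theta>" "\<theta> \<le> 1" for \<theta>
  proof -
    have ce: "cross_entropy T C \<psi>1 \<psi>2 (layer_path S Q P \<theta>) - cross_entropy T C \<psi>1 \<psi>2 A \<le> (1 - \<theta>) * B P"
      unfolding A B_def using assms(7) that by (rule cross_entropy_layer_path_diff_le)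
    have sq: "(norm (layer_path S Q P \<theta>))\<^sup>2 = (norm A)\<^sup>2 - (1 - \<theta>\<^sup>2) * (norm P)\<^sup>2"
      unfolding A layer_path_def penalties by (simp add: algebra_simps)
    \<comment> \<open>The identity is used at \<open>t = \<theta>\<close> and at
      \<open>t = 1\<close>; \<open>zero_le_one\<close> settles the sign condition of the
      latter.\<close>
    have l1: "entry_l1_norm (layer_path S Q P \<theta>) = entry_l1_norm A - (1 - \<theta>) * entry_l1_norm P"
      unfolding A layer_path_def using that by (simp only: penalties zero_le_one) (simp add: algebra_simps)
    \<comment> \<open>Both penalty changes are exact, so the estimate \<open>ce\<close> is the only
      source of inequality.\<close>
    from ce show ?thesis
      unfolding J_def elastic_net_def sq l1 by (simp add: algebra_simps)
  qed
  have "layer_path S Q P 0 = S + Q"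
    by (simp add: layer_path_def)
  with path[of 0] have "J (S + Q) \<le> J A - lam2 * (norm P)\<^sup>2 - lam1 * entry_l1_norm P + B P"
    by simp
  with path show ?thesis
    by auto
qed

end
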